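(* Let $K$ be an algebraically closed field, complete with respect to a nontrivial non-archimedean absolute value $|\cdot|$, and let $d\ge1$. For any ultrametric norm $\|\cdot\|_0$ on $K^d$ and any bounded subset $S\subset M_d(K)$, $$\|S^d\|_0\le\rho(S)\,\|S\|_0^{d-1}.$$
   Context: An ultrametric norm on $K^d$ is a map $\|\cdot\|:K^d\to\mathbb{R}_{\ge0}$ with $\|\lambda x\|=|\lambda|\|x\|$, $\|x+y\|\le\max\{\|x\|,\|y\|\}$, and $\|x\|=0$ iff $x=0$, for all $x,y\in K^d$, $\lambda\in K$; the same symbol denotes its associated operator norm on $M_d(K)$, and $\|S\|:=\sup_{s\in S}\|s\|$ for $S\subset M_d(K)$. For $n\ge1$, $S^n:=\{s_1\cdots s_n: s_i\in S\}$. The joint spectral radius of a bounded set $S\subset M_d(K)$ is $\rho(S):=\lim_{n\to+\infty}\|S^n\|^{1/n}$ (independent of the choice of ultrametric norm). *)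

theory Defs
  imports "HOL-Analysis.Analysis" "HOL-Computational_Algebra.Polynomial"
begin

locale nonarch_abs =
  fixes v :: "'k::field \<Rightarrow> real"
  assumes nonneg: "v x \<ge> 0"
    and eq_0_iff: "v x = 0 \<longleftrightarrow> x = 0"
    and mult: "v (x * y) = v x * v y"
    and ultra: "v (x + y) \<le> max (v x) (v y)"

locale complete_nontrivial_nonarch_abs = nonarch_abs +
  assumes nontrivial: "\<exists>x. x \<noteq> 0 \<and> v x \<noteq> 1"
    and complete: "Metric_space.mcomplete UNIV (\<lambda>x y. v (x - y))"

locale ultrametric_norm =
  fixes v :: "'k::field \<Rightarrow> real" and N :: "'k ^ 'n::finite \<Rightarrow> real"
  assumes nonneg: "N x \<ge> 0"
    and scale: "N (c *s x) = v c * N x"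
    and ultra: "N (x + y) \<le> max (N x) (N y)"
    and eq_0_iff: "N x = 0 \<longleftrightarrow> x = 0"

definition op_norm :: "('k::field ^ 'n::finite \<Rightarrow> real) \<Rightarrow> 'k ^ 'n ^ 'n \<Rightarrow> real" where
  "op_norm N A = Sup {N (A *v x) / N x | x. x \<noteq> 0}"

(* The supremum is taken in [0, \<infinity>), so that the empty set has norm 0;
   for nonempty S the inserted 0 changes nothing. *)
definition set_norm :: "('k::field ^ 'n::finite \<Rightarrow> real) \<Rightarrow> ('k ^ 'n ^ 'n) set \<Rightarrow> real" where
  "set_norm N S = Sup (insert 0 (op_norm N ` S))"

definition set_power :: "('k::field ^ 'n::finite ^ 'n) set \<Rightarrow> nat \<Rightarrow> ('k ^ 'n ^ 'n) set" where
  "set_power S n = {foldr (**) ss (mat 1) | ss. length ss = n \<and> set ss \<subseteq> S}"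

(* Boundedness in M_d(K) identified with K^(d^2), i.e. for the maximum norm of the entries;
   over a complete field all norms on this space are equivalent. *)
definition bounded_matrices :: "('k::field \<Rightarrow> real) \<Rightarrow> ('k ^ 'n::finite ^ 'n) set \<Rightarrow> bool" where
  "bounded_matrices v S \<longleftrightarrow> (\<exists>C. \<forall>A\<in>S. \<forall>i j. v (A $ i $ j) \<le> C)"

(* For bounded S over a complete field the limit exists and does not depend on the
   ultrametric norm N used to compute it. *)
definition joint_spectral_radius ::
  "('k::field ^ 'n::finite \<Rightarrow> real) \<Rightarrow> ('k ^ 'n ^ 'n) set \<Rightarrow> real" where
  "joint_spectral_radius N S = lim (\<lambda>n. root n (set_norm N (set_power S n)))"

end

theory Submission
  imports Defs
begin

text \<open>
  Over a complete field all ultrametric norms are equivalent, so for every \<open>q > \<rho>(S)\<close> the norm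
  \<open>N'(x) = sup \<parallel>A x\<parallel>\<^sub>0 / q\<^sup>n\<close> over all \<open>n\<close> and \<open>A \<in> S\<^sup>n\<close> is finite; it dominates \<open>\<parallel>\<cdot>\<parallel>\<^sub>0\<close>, and
  every element of \<open>S\<close> has operator norm at most \<open>q\<close> for it. Let \<open>r > q\<close> and \<open>M = \<parallel>S\<parallel>\<^sub>0 \<ge> r\<close>,
  and suppose that an orbit \<open>x\<^sub>0, \<dots>, x\<^sub>d\<close> violates \<open>\<parallel>x\<^sub>d\<parallel>\<^sub>0 \<le> r M\<^sup>d\<^sup>-\<^sup>1 \<parallel>x\<^sub>0\<parallel>\<^sub>0\<close>. Replace each
  \<open>x\<^sub>k\<close> by a vector \<open>y\<^sub>k\<close> that nearly minimises \<open>N'\<close> among the vectors whose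
  \<open>\<parallel>\<cdot>\<parallel>\<^sub>0\<close>-distance to \<open>x\<^sub>k\<close> is less than \<open>\<parallel>x\<^sub>d\<parallel>\<^sub>0 / M\<^sup>d\<^sup>-\<^sup>k\<close>. The \<open>d + 1\<close> vectors \<open>y\<^sub>k\<close> satisfy
  a linear relation with coefficients \<open>a\<^sub>k\<close>. Solving it for \<open>y\<^sub>j\<close>, where \<open>\<bar>a\<^sub>j\<bar> r\<^sup>j\<close> is maximal, the
  terms with \<open>k < j\<close> are negligible for \<open>\<parallel>\<cdot>\<parallel>\<^sub>0\<close>, while the sum of the terms with \<open>k > j\<close> has smaller
  \<open>N'\<close> than the minimum, a contradiction.
\<close>

section \<open>Submultiplicative sequences\<close>

text \<open>Division with remainder \<open>n = q * m + s\<close> gives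
  \<open>a n \<le> a m ^ q * a s\<close> with \<open>a m \<le> r ^ m\<close>. One index
  \<open>m\<close> thus controls the growth, up to the finitely many remainders that
  \<open>C\<close> absorbs.\<close>

lemma submultiplicative_bound:
  fixes a :: "nat \<Rightarrow> real"
  assumes nonneg: "\<And>n. a n \<ge> 0"
    and submult: "\<And>m n. a (m + n) \<le> a m * a n"
    and m: "m > 0" "root m (a m) < r"
  shows "\<exists>C>0. \<forall>n. a n \<le> C * r ^ n"
proof -
  have r: "r > 0"
    using m nonneg[of m] real_root_ge_zero[of "a m" m] by linarith
  have am: "a m \<le> r ^ m"
  proof -
    have "a m = root m (a m) ^ m"
      using m nonneg by simp
    also have "\<dots> \<le> r ^ m"
      using m nonneg by (intro power_mono) auto
    finally show ?thesis .
  qed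
  have iter: "a (q * m + s) \<le> (r ^ m) ^ q * a s" for q s
  proof (induction q)
    case (Suc q)
    have "a (Suc q * m + s) \<le> a m * a (q * m + s)"
      using submult[of m "q * m + s"] by (simp add: add.assoc)
    also have "\<dots> \<le> r ^ m * ((r ^ m) ^ q * a s)"
      using am Suc nonneg r by (intro mult_mono) auto
    finally show ?case by (simp add: mult.assoc)
  qed simp
  \<comment> \<open>The sum dominates every \<open>a s / r ^ s\<close>; the summand 1 makes
    \<open>C\<close> positive even if all of them vanish.\<close>
  define C where "C = 1 + (\<Sum>s<m. a s / r ^ s)"
  have sum_nonneg: "(\<Sum>s<m. a s / r ^ s) \<ge> 0"
    using r nonneg by (intro sum_nonneg) simp
  have "a n \<le> C * r ^ n" for n
  proof -
    define q s where "q = n div m" and "s = n mod m"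
    have n: "n = q * m + s" and s: "s < m"
      using m by (auto simp: q_def s_def)
    have "a s / r ^ s \<le> (\<Sum>s<m. a s / r ^ s)"
      using s r nonneg by (intro member_le_sum) auto
    hence "a s / r ^ s \<le> C" by (simp add: C_def)
    hence "a s \<le> C * r ^ s"
      using r by (simp add: pos_divide_le_eq)
    hence "(r ^ m) ^ q * a s \<le> (r ^ m) ^ q * (C * r ^ s)"
      using r by (intro mult_left_mono) auto
    also have "\<dots> = C * r ^ n"
      unfolding n power_add power_mult mult.commute[of q m] by simp
    finally show ?thesis
      using iter[of q s] n by simp
  qed
  moreover have "C > 0"
    using sum_nonneg by (simp add: C_def)
  ultimately show ?thesis by blast
qed

text \<open>Multiplicative form of Fekete's lemma: the limit is the infimum. A bound
  \<open>C * r ^ n\<close> with \<open>r\<close> slightly above the infimum gives the upper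
  estimate, since the n-th root of \<open>C\<close> tends to 1. No logarithm is taken, so vanishing
  terms are harmless.\<close>

lemma submultiplicative_root_convergent:
  fixes a :: "nat \<Rightarrow> real"
  assumes nonneg: "\<And>n. a n \<ge> 0"
    and submult: "\<And>m n. a (m + n) \<le> a m * a n"
  shows "convergent (\<lambda>n. root n (a n))"
proof -
  \<comment> \<open>Index 0 is left out because \<open>root 0\<close> is constantly 0 and would pull
    the infimum down to 0.\<close>
  define L where "L = (INF n\<in>{0<..}. root n (a n))"
  have bdd: "bdd_below ((\<lambda>n. root n (a n)) ` {0<..})"
    using nonneg by (intro bdd_belowI2[of _ 0]) auto
  have "(\<lambda>n. root n (a n)) \<longlonglongrightarrow> L"
  proof (rule order_tendstoI)
    fix l assume "l < L"
    have "L \<le> root n (a n)" if "n > 0" for n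
      unfolding L_def using bdd that by (intro cINF_lower) auto
    thus "eventually (\<lambda>n. l < root n (a n)) sequentially"
      using \<open>l < L\<close> less_le_trans by (intro eventually_mono[OF eventually_gt_at_top[of 0]]) blast
  next
    fix u assume "L < u"
    then obtain r where r: "L < r" "r < u" using dense[OF \<open>L < u\<close>] by blast
    obtain m where m: "m > 0" "root m (a m) < r"
      using cINF_less_iff[of "{0<..}" "\<lambda>n. root n (a n)" r] bdd r(1)
      unfolding L_def by auto
    have r0: "r > 0"
      using m nonneg[of m] real_root_ge_zero[of "a m" m] by linarith
    obtain C where C: "C > 0" "\<And>n. a n \<le> C * r ^ n"
      using submultiplicative_bound[OF nonneg submult m] by blast
    have "(\<lambda>n. root n C * r) \<longlonglongrightarrow> 1 * r"
      by (intro tendsto_intros LIMSEQ_root_const C)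
    hence "eventually (\<lambda>n. root n C * r < u) sequentially"
      using r(2) by (intro order_tendstoD) simp_all
    thus "eventually (\<lambda>n. root n (a n) < u) sequentially"
      using eventually_gt_at_top[of 0]
    proof eventually_elim
      case (elim n)
      have "root n (a n) \<le> root n (C * r ^ n)"
        using elim C by simp
      also have "\<dots> = root n C * r"
        using elim r0 by (simp add: real_root_mult real_root_power_cancel)
      finally show ?case using elim by simp
    qed
  qed
  thus ?thesis by (rule convergentI)
qed

section \<open>Ultrametric norms\<close>

lemma (in nonarch_abs) v_1 [simp]: "v 1 = 1"
  using mult[of 1 1] eq_0_iff[of 1] by auto

lemma (in nonarch_abs) v_0 [simp]: "v 0 = 0"
  using eq_0_iff by simp

lemma (in nonarch_abs) v_minus [simp]: "v (- x) = v x"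
proof -
  have "v (- 1) * v (- 1) = 1"
    using mult[of "- 1" "- 1"] by simp
  hence "v (- 1) = 1"
    using nonneg[of "- 1"] by (metis abs_of_nonneg real_sqrt_abs2 real_sqrt_one)
  thus ?thesis using mult[of "- 1" x] by simp
qed

lemma (in nonarch_abs) v_inverse: "v (inverse x) = inverse (v x)"
proof (cases "x = 0")
  case False
  hence "v x * v (inverse x) = 1"
    using mult[of x "inverse x"] by simp
  thus ?thesis by (simp add: inverse_unique)
qed simp

locale ultrametric_vector_space = abs: nonarch_abs v + ultrametric_norm v N
  for v :: "'k::field \<Rightarrow> real" and N :: "'k ^ 'n::finite \<Rightarrow> real"
begin

lemma zero [simp]: "N 0 = 0"
  using eq_0_iff by simp

lemma uminus [simp]: "N (- x) = N x"
  using scale[of "- 1" x] by simp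

lemma ultra_diff: "N (x - y) \<le> max (N x) (N y)"
  using ultra[of x "- y"] by simp

lemma pos: "x \<noteq> 0 \<Longrightarrow> N x > 0"
  using nonneg[of x] eq_0_iff[of x] by linarith

lemma sum_le:
  assumes "c \<ge> 0" "\<And>i. i \<in> I \<Longrightarrow> N (f i) \<le> c"
  shows "N (\<Sum>i\<in>I. f i) \<le> c"
  using assms(2)
proof (induction I rule: infinite_finite_induct)
  case (insert i I)
  thus ?case using ultra[of "f i" "\<Sum>i\<in>I. f i"] by fastforce
qed (use assms(1) in simp_all)

lemma sum_less:
  assumes "c > 0" "\<And>i. i \<in> I \<Longrightarrow> N (f i) < c"
  shows "N (\<Sum>i\<in>I. f i) < c"
  using assms(2)
proof (induction I rule: infinite_finite_induct)
  case (insert i I)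
  thus ?case using ultra[of "f i" "\<Sum>i\<in>I. f i"] by fastforce
qed (use assms(1) in simp_all)

text \<open>The easy half of the comparison with the maximum norm: expand \<open>x\<close> in the
  standard basis and apply \<open>sum_le\<close>.\<close>

lemma le_coordinates: "\<exists>C>0. \<forall>x b. (\<forall>i. v (x $ i) \<le> b) \<longrightarrow> N x \<le> C * b"
proof -
  define C where "C = 1 + (\<Sum>i\<in>UNIV. N (axis i 1))"
  have C0: "C > 0"
    using sum_nonneg[of UNIV "\<lambda>i. N (axis i 1)"] nonneg by (simp add: C_def add_pos_nonneg)
  have "N x \<le> C * b" if b: "\<And>i. v (x $ i) \<le> b" for x b
  proof -
    have b0: "b \<ge> 0" using b abs.nonneg order_trans by blast
    have "N (\<Sum>i\<in>UNIV. (x $ i) *s axis i 1) \<le> C * b"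
    proof (rule sum_le)
      fix i
      have "N (axis i 1) \<le> (\<Sum>i\<in>UNIV. N (axis i 1))"
        using nonneg by (intro member_le_sum) auto
      hence "N (axis i 1) \<le> C" by (simp add: C_def)
      hence "v (x $ i) * N (axis i 1) \<le> b * C"
        using b nonneg b0 by (intro mult_mono) auto
      thus "N ((x $ i) *s axis i 1) \<le> C * b"
        by (simp add: scale mult.commute)
    qed (use C0 b0 in simp)
    thus ?thesis by (simp add: basis_expansion)
  qed
  thus ?thesis using C0 by blast
qed

end

text \<open>More vectors than the dimension are dependent. Dependence is a property of sets and does
  not see repetitions, so a repeated vector is treated separately, with coefficients 1 and
  -1.\<close>

lemma linear_relation:
  fixes y :: "nat \<Rightarrow> 'k::field ^ 'n::finite"
  shows "\<exists>a. (\<exists>k\<le>CARD('n). a k \<noteq> 0) \<and> (\<Sum>k\<le>CARD('n). a k *s y k) = 0"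
proof (cases "inj_on y {..CARD('n)}")
  case True
  hence card: "card (y ` {..CARD('n)}) = Suc CARD('n)"
    by (simp add: card_image)
  have "vec.dependent (y ` {..CARD('n)})"
    using vec.independent_card_le_dim[of "y ` {..CARD('n)}" UNIV] card
    unfolding vec_dim_card by auto
  then obtain u where u: "\<exists>w\<in>y ` {..CARD('n)}. u w \<noteq> 0" "(\<Sum>w\<in>y ` {..CARD('n)}. u w *s w) = 0"
    using vec.dependent_finite[of "y ` {..CARD('n)}"] by auto
  have "(\<Sum>k\<le>CARD('n). u (y k) *s y k) = 0"
    using u(2) by (simp add: sum.reindex[OF True])
  thus ?thesis using u(1) by (intro exI[of _ "u \<circ> y"]) auto
next
  case False
  then obtain i j where ij: "i \<le> CARD('n)" "j \<le> CARD('n)" "i \<noteq> j" "y i = y j"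
    by (auto simp: inj_on_def)
  define a where "a = (\<lambda>k. if k = i then 1 else if k = j then - 1 else 0 :: 'k)"
  have "(\<Sum>k\<le>CARD('n). a k *s y k) = (\<Sum>k\<in>{i, j}. a k *s y k)"
    using ij by (intro sum.mono_neutral_right) (auto simp: a_def)
  also have "\<dots> = 0" using ij by (simp add: a_def)
  finally show ?thesis using ij by (intro exI[of _ a]) (auto simp: a_def)
qed


lemma (in nonarch_abs) v_sum_le:
  assumes "c \<ge> 0" "\<And>i. i \<in> I \<Longrightarrow> v (f i) \<le> c"
  shows "v (\<Sum>i\<in>I. f i) \<le> c"
  using assms(2)
proof (induction I rule: infinite_finite_induct)
  case (insert i I)
  thus ?case using ultra[of "f i" "\<Sum>i\<in>I. f i"] by fastforce
qed (use assms(1) in simp_all)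

lemma (in nonarch_abs) Metric_space_v: "Metric_space UNIV (\<lambda>x y. v (x - y))"
proof
  fix x y z
  show "v (x - y) = v (y - x)" using v_minus[of "x - y"] by simp
  show "v (x - z) \<le> v (x - y) + v (y - z)"
    using ultra[of "x - y" "y - z"] nonneg[of "x - y"] nonneg[of "y - z"] by simp
qed (use nonneg eq_0_iff in auto)

section \<open>Equivalence of ultrametric norms over a complete field\<close>

locale complete_ultrametric_vector_space = ultrametric_vector_space +
  assumes complete: "Metric_space.mcomplete UNIV (\<lambda>x y. v (x - y))"
begin

text \<open>
  Otherwise \<open>- axis j 1\<close> would be a limit of vectors supported on \<open>I\<close>; by the assumption on \<open>I\<close> and
  completeness these converge coordinatewise to a vector supported on \<open>I\<close>.
\<close>

lemma axis_distance_pos: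
  assumes c: "\<And>x i. (\<forall>i. i \<notin> I \<longrightarrow> x $ i = 0) \<Longrightarrow> v (x $ i) \<le> c * N x" "c > 0"
    and j: "j \<notin> I"
  shows "\<exists>b>0. \<forall>w. (\<forall>i. i \<notin> I \<longrightarrow> w $ i = 0) \<longrightarrow> b \<le> N (axis j 1 + w)"
proof (rule ccontr)
  interpret M: Metric_space UNIV "\<lambda>x y. v (x - y)" by (rule abs.Metric_space_v)
  let ?e = "axis j 1"
  assume "\<not> ?thesis"
  hence "\<exists>w. (\<forall>i. i \<notin> I \<longrightarrow> w $ i = 0) \<and> N (?e + w) < inverse (real (Suc n))" for n
    by (metis inverse_positive_iff_positive not_le of_nat_0_less_iff zero_less_Suc)
  then obtain w where w: "\<And>n i. i \<notin> I \<Longrightarrow> w n $ i = 0"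
    "\<And>n. N (?e + w n) < inverse (real (Suc n))"
    by metis
  \<comment> \<open>Differences of the \<open>w n\<close> are supported on \<open>I\<close>, where
    \<open>N\<close> controls the coordinates; hence each coordinate sequence is Cauchy.\<close>
  have "\<exists>l. \<forall>\<epsilon>>0. \<exists>n0. \<forall>n\<ge>n0. v (w n $ i - l) < \<epsilon>" for i
  proof -
    have "\<exists>n0. \<forall>m n. n0 \<le> m \<longrightarrow> n0 \<le> n \<longrightarrow> v (w m $ i - w n $ i) < \<epsilon>" if "\<epsilon> > 0" for \<epsilon>
    proof -
      obtain n0 where n0: "inverse (real (Suc n0)) < \<epsilon> / c"
        using reals_Archimedean[of "\<epsilon> / c"] divide_pos_pos[OF \<open>\<epsilon> > 0\<close> c(2)] by blast
      have *: "N (?e + w n) < \<epsilon> / c" if "n \<ge> n0" for n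
      proof -
        have "inverse (real (Suc n)) \<le> inverse (real (Suc n0))"
          using that by (intro le_imp_inverse_le) auto
        thus ?thesis using w(2)[of n] n0 by linarith
      qed
      have "v (w m $ i - w n $ i) < \<epsilon>" if "n0 \<le> m" "n0 \<le> n" for m n
      proof -
        have "v ((w m - w n) $ i) \<le> c * N (w m - w n)"
          using w(1) by (intro c(1)) simp
        moreover have "N (w m - w n) < \<epsilon> / c"
          using ultra_diff[of "?e + w m" "?e + w n"] *[OF that(1)] *[OF that(2)] by simp
        ultimately show ?thesis using c(2) by (simp add: field_simps)
      qed
      thus ?thesis by blast
    qed
    hence "M.MCauchy (\<lambda>n. w n $ i)"
      by (auto simp: M.MCauchy_def)
    then obtain l where "limitin M.mtopology (\<lambda>n. w n $ i) l sequentially"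
      using complete unfolding M.mcomplete_def by blast
    thus ?thesis by (auto simp: M.limit_metric_sequentially)
  qed
  then obtain l where l: "\<And>i \<epsilon>. \<epsilon> > 0 \<Longrightarrow> \<exists>n0. \<forall>n\<ge>n0. v (w n $ i - l i) < \<epsilon>"
    by metis
  \<comment> \<open>Outside \<open>I\<close> all \<open>w n\<close> vanish, so the limit there is 0;
    writing it into \<open>W\<close> makes the support evident.\<close>
  define W where "W = (\<chi> i. if i \<in> I then l i else 0)"
  have W: "eventually (\<lambda>n. v (w n $ i - W $ i) < \<epsilon>) sequentially" if "\<epsilon> > 0" for i \<epsilon>
    using l[OF that, of i] w(1) that by (auto simp: W_def eventually_sequentially)
  obtain U where U: "U > 0" "\<And>x b. (\<forall>i. v (x $ i) \<le> b) \<Longrightarrow> N x \<le> U * b"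
    using le_coordinates by blast
  have "N (?e + W) \<le> \<epsilon>" if "\<epsilon> > 0" for \<epsilon>
  proof -
    have "eventually (\<lambda>n. \<forall>i. v (w n $ i - W $ i) < \<epsilon> / U) sequentially"
      using W[of "\<epsilon> / U"] that U(1) by (intro eventually_all_finite) simp
    moreover have "eventually (\<lambda>n. inverse (real (Suc n)) < \<epsilon>) sequentially"
      using LIMSEQ_inverse_real_of_nat that by (rule order_tendstoD)
    ultimately have "eventually (\<lambda>n. (\<forall>i. v (w n $ i - W $ i) < \<epsilon> / U)
        \<and> inverse (real (Suc n)) < \<epsilon>) sequentially"
      by (rule eventually_conj)
    then obtain n where n: "\<forall>i. v (w n $ i - W $ i) < \<epsilon> / U" "inverse (real (Suc n)) < \<epsilon>"
      by (auto dest: eventually_happens)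
    have "N (w n - W) \<le> U * (\<epsilon> / U)"
      using n(1) by (intro U(2)) (simp add: less_imp_le)
    thus ?thesis
      using ultra_diff[of "?e + w n" "w n - W"] w(2)[of n] n(2) U(1) by simp
  qed
  hence "N (?e + W) = 0"
    using nonneg[of "?e + W"] by (meson dense_ge order_antisym)
  hence "(?e + W) $ j = 0" using eq_0_iff by simp
  thus False using j by (simp add: W_def)
qed

text \<open>Induction on a finite set \<open>I\<close> supporting \<open>x\<close>. For a new index
  \<open>j\<close>, the positive distance of \<open>axis j 1\<close> from the vectors supported on
  \<open>I\<close> controls \<open>x $ j\<close>; the remainder \<open>y\<close> is supported on
  \<open>I\<close> and falls under the induction hypothesis.\<close>

lemma coordinates_le: "\<exists>C>0. \<forall>x i. v (x $ i) \<le> C * N x"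
proof -
  have "\<exists>c>0. \<forall>x. (\<forall>i. i \<notin> I \<longrightarrow> x $ i = 0) \<longrightarrow> (\<forall>i. v (x $ i) \<le> c * N x)"
    if "finite I" for I :: "'b set"
    using that
  proof (induction I)
    case empty
    show ?case using nonneg by (intro exI[of _ 1]) auto
  next
    case (insert j I)
    then obtain c where c: "c > 0" "\<And>x i. (\<forall>i. i \<notin> I \<longrightarrow> x $ i = 0) \<Longrightarrow> v (x $ i) \<le> c * N x"
      by blast
    define e :: "'a ^ 'b" where "e = axis j 1"
    obtain b where b: "b > 0" "\<And>w. (\<forall>i. i \<notin> I \<longrightarrow> w $ i = 0) \<Longrightarrow> b \<le> N (e + w)"
      using axis_distance_pos[OF c(2,1) insert.hyps(2)] unfolding e_def by blast
    \<comment> \<open>The term \<open>1 / b\<close> serves the coordinate \<open>j\<close>, the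
      other term the remaining coordinates, because
      \<open>N y \<le> (1 + N e / b) * N x\<close>.\<close>
    define c' where "c' = 1 / b + c * (1 + N e / b)"
    have "v (x $ i) \<le> c' * N x" if x: "\<And>i. i \<notin> insert j I \<Longrightarrow> x $ i = 0" for x i
    proof -
      define y where "y = x - (x $ j) *s e"
      have y: "y $ i = (if i = j then 0 else x $ i)" for i
        by (simp add: y_def e_def axis_def)
      have xj: "v (x $ j) \<le> N x / b"
      proof (cases "x $ j = 0")
        case False
        \<comment> \<open>Dividing \<open>x\<close> by \<open>x $ j\<close> normalises its
          coordinate \<open>j\<close> to 1, so the distance bound \<open>b\<close> applies.\<close>
        have "b \<le> N (e + inverse (x $ j) *s y)"
          using x y by (intro b(2)) auto
        also have "e + inverse (x $ j) *s y = inverse (x $ j) *s x"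
          using False by (simp add: y_def vec_eq_iff algebra_simps)
        finally have "b \<le> N x / v (x $ j)"
          by (simp add: scale abs.v_inverse divide_inverse mult.commute)
        moreover have "v (x $ j) > 0"
          using False abs.nonneg abs.eq_0_iff less_eq_real_def by metis
        ultimately show ?thesis using b(1) by (simp add: field_simps)
      qed (use nonneg b(1) in simp)
      have "N y \<le> (1 + N e / b) * N x"
      proof -
        have "v (x $ j) * N e \<le> N x / b * N e"
          using xj nonneg by (intro mult_right_mono)
        moreover have "N x / b * N e \<ge> 0" using nonneg b(1) by simp
        moreover have "N y \<le> max (N x) (v (x $ j) * N e)"
          unfolding y_def using ultra_diff scale by metis
        ultimately show ?thesis using nonneg[of x] by (simp add: algebra_simps)
      qed
      hence cy: "c * N y \<le> c * (1 + N e / b) * N x"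
        using c(1) by (simp add: mult.assoc)
      have "v (y $ i) \<le> c * N y"
        using x y by (intro c(2)) auto
      hence "v (x $ i) \<le> max (N x / b) (c * (1 + N e / b) * N x)"
        using xj cy y[of i] by (auto split: if_splits)
      moreover have "N x / b \<ge> 0" "c * (1 + N e / b) * N x \<ge> 0"
        using b(1) c(1) nonneg by simp_all
      ultimately show ?thesis by (simp add: c'_def distrib_right)
    qed
    moreover have "c' > 0"
      unfolding c'_def using b(1) c(1) nonneg[of e]
      by (intro add_pos_nonneg mult_nonneg_nonneg) simp_all
    ultimately show ?case by blast
  qed
  from this[of UNIV] show ?thesis by simp
qed

lemma equivalent:
  assumes "ultrametric_norm v N'"
  shows "\<exists>C>0. \<forall>x. N' x \<le> C * N x"
proof -
  interpret N': ultrametric_vector_space v N'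
    using assms by (simp add: ultrametric_vector_space_def abs.nonarch_abs_axioms)
  obtain U where U: "U > 0" "\<And>x b. (\<forall>i. v (x $ i) \<le> b) \<Longrightarrow> N' x \<le> U * b"
    using N'.le_coordinates by blast
  obtain C where C: "C > 0" "\<And>x i. v (x $ i) \<le> C * N x"
    using coordinates_le by blast
  have "N' x \<le> (U * C) * N x" for x
    using U(2)[of x "C * N x"] C(2) by (simp add: mult.assoc)
  thus ?thesis using U(1) C(1) by (intro exI[of _ "U * C"]) simp
qed

text \<open>Stated vectorwise rather than through \<open>op_norm\<close>: a supremum of reals is an
  upper bound only once its set is known to be bounded.\<close>

lemma bounded_matrices_imp_bounded:
  assumes "bounded_matrices v S"
  shows "\<exists>C>0. \<forall>A\<in>S. \<forall>x. N (A *v x) \<le> C * N x"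
proof -
  obtain B0 where B0: "\<And>A i j. A \<in> S \<Longrightarrow> v (A $ i $ j) \<le> B0"
    using assms by (auto simp: bounded_matrices_def)
  \<comment> \<open>\<open>B0\<close> may be negative when \<open>S\<close> is empty; the maximum
    secures a positive bound.\<close>
  define B where "B = max B0 1"
  have B: "B > 0" "\<And>A i j. A \<in> S \<Longrightarrow> v (A $ i $ j) \<le> B"
    using B0 by (auto simp: B_def le_max_iff_disj)
  obtain U where U: "U > 0" "\<And>x b. (\<forall>i. v (x $ i) \<le> b) \<Longrightarrow> N x \<le> U * b"
    using le_coordinates by blast
  obtain C where C: "C > 0" "\<And>x i. v (x $ i) \<le> C * N x"
    using coordinates_le by blast
  have "N (A *v x) \<le> (U * (B * C)) * N x" if "A \<in> S" for A x
  proof -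
    have "v ((A *v x) $ i) \<le> B * (C * N x)" for i
      unfolding matrix_vector_mult_def vec_lambda_beta
    proof (rule abs.v_sum_le)
      show "v (A $ i $ j * x $ j) \<le> B * (C * N x)" for j
        unfolding abs.mult using B that C abs.nonneg by (intro mult_mono) auto
    qed (use B C nonneg in simp)
    thus ?thesis using U(2)[of "A *v x"] by (simp add: mult.assoc)
  qed
  thus ?thesis using U(1) B(1) C(1) by (intro exI[of _ "U * (B * C)"]) simp
qed

end

section \<open>Operator norms and powers of matrix sets\<close>

lemma set_powerE:
  assumes "A \<in> set_power S n"
  obtains ss where "A = foldr (**) ss (mat 1)" "length ss = n" "set ss \<subseteq> S"
  using assms by (auto simp: set_power_def)

lemma set_powerI: "length ss = n \<Longrightarrow> set ss \<subseteq> S \<Longrightarrow> foldr (**) ss (mat 1) \<in> set_power S n"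
  by (auto simp: set_power_def)

lemma foldr_matrix_append:
  "foldr (**) (xs @ ys) (mat 1) = foldr (**) xs (mat 1) ** foldr (**) ys (mat 1)"
  by (induction xs) (simp_all add: matrix_mul_assoc)

lemma set_power_addE:
  assumes "A \<in> set_power S (m + n)"
  obtains B C where "B \<in> set_power S m" "C \<in> set_power S n" "A = B ** C"
proof -
  obtain ss where ss: "A = foldr (**) ss (mat 1)" "length ss = m + n" "set ss \<subseteq> S"
    using assms by (rule set_powerE)
  have "A = foldr (**) (take m ss) (mat 1) ** foldr (**) (drop m ss) (mat 1)"
    unfolding ss(1) foldr_matrix_append[symmetric] by simp
  moreover have "foldr (**) (take m ss) (mat 1) \<in> set_power S m"
    "foldr (**) (drop m ss) (mat 1) \<in> set_power S n"
    using ss(2,3) set_take_subset[of m ss] set_drop_subset[of m ss]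
    by (auto intro!: set_powerI)
  ultimately show ?thesis using that by blast
qed

text \<open>The new factor stands on the right and so acts first, as needed to evaluate the adapted
  norm at \<open>s *v x\<close>.\<close>

lemma set_power_mult_right:
  assumes "A \<in> set_power S n" "s \<in> S"
  shows "A ** s \<in> set_power S (Suc n)"
proof -
  obtain ss where ss: "A = foldr (**) ss (mat 1)" "length ss = n" "set ss \<subseteq> S"
    using assms(1) by (rule set_powerE)
  have "A ** s = foldr (**) (ss @ [s]) (mat 1)"
    unfolding foldr_matrix_append ss(1) by simp
  moreover have "foldr (**) (ss @ [s]) (mat 1) \<in> set_power S (Suc n)"
    using ss(2,3) assms(2) by (intro set_powerI) auto
  ultimately show ?thesis by simp
qed

lemma set_power_0: "set_power S 0 = {mat 1}"
  by (auto simp: set_power_def)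

context ultrametric_vector_space
begin

lemma op_norm_le:
  assumes "\<And>x. N (A *v x) \<le> C * N x"
  shows "op_norm N A \<le> C"
  unfolding op_norm_def
proof (rule cSup_least)
  \<comment> \<open>The supremum needs a nonempty set; a basis vector at an arbitrary index provides
    an element.\<close>
  have "axis undefined 1 \<noteq> (0 :: 'k ^ 'n)" by simp
  thus "{N (A *v x) / N x | x. x \<noteq> 0} \<noteq> {}" by blast
qed (use assms pos in \<open>auto simp: pos_divide_le_eq\<close>)

lemma le_op_norm:
  assumes "\<And>x. N (A *v x) \<le> C * N x"
  shows "N (A *v x) \<le> op_norm N A * N x"
proof (cases "x = 0")
  case False
  have "bdd_above {N (A *v x) / N x | x. x \<noteq> 0}"
    using assms pos by (intro bdd_aboveI[of _ C]) (auto simp: pos_divide_le_eq)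
  hence "N (A *v x) / N x \<le> op_norm N A"
    unfolding op_norm_def using False by (intro cSup_upper) auto
  thus ?thesis using pos[OF False] by (simp add: pos_divide_le_eq)
qed simp

lemma set_norm_le:
  assumes "C \<ge> 0" "\<And>A x. A \<in> S \<Longrightarrow> N (A *v x) \<le> C * N x"
  shows "set_norm N S \<le> C"
  unfolding set_norm_def using assms op_norm_le by (intro cSup_least) auto

lemma
  assumes "\<And>A x. A \<in> S \<Longrightarrow> N (A *v x) \<le> C * N x"
  shows le_set_norm: "A \<in> S \<Longrightarrow> N (A *v x) \<le> set_norm N S * N x"
    and set_norm_nonneg: "set_norm N S \<ge> 0"
proof -
  have bdd: "bdd_above (insert 0 (op_norm N ` S))"
    using assms op_norm_le by (intro bdd_aboveI[of _ "max 0 C"]) (auto simp: le_max_iff_disj)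
  show "set_norm N S \<ge> 0"
    unfolding set_norm_def using bdd by (intro cSup_upper) auto
  assume "A \<in> S"
  hence "op_norm N A \<le> set_norm N S"
    unfolding set_norm_def using bdd by (intro cSup_upper) auto
  hence "op_norm N A * N x \<le> set_norm N S * N x"
    using nonneg by (rule mult_right_mono)
  thus "N (A *v x) \<le> set_norm N S * N x"
    using le_op_norm[OF assms[OF \<open>A \<in> S\<close>], of x] by linarith
qed

lemma set_power_bound:
  assumes "C \<ge> 0" "\<And>A x. A \<in> S \<Longrightarrow> N (A *v x) \<le> C * N x"
    and "A \<in> set_power S n"
  shows "N (A *v x) \<le> C ^ n * N x"
proof -
  obtain ss where ss: "A = foldr (**) ss (mat 1)" "length ss = n" "set ss \<subseteq> S"
    using assms(3) by (rule set_powerE)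
  have "N (foldr (**) ss (mat 1) *v x) \<le> C ^ length ss * N x"
    using ss(3)
  proof (induction ss)
    case (Cons s ss)
    have "N (s *v (foldr (**) ss (mat 1) *v x)) \<le> C * N (foldr (**) ss (mat 1) *v x)"
      using Cons.prems by (intro assms(2)) simp
    also have "\<dots> \<le> C * (C ^ length ss * N x)"
      using Cons assms(1) by (intro mult_left_mono) auto
    finally show ?case by (simp add: matrix_vector_mul_assoc mult.assoc)
  qed simp
  thus ?thesis using ss by simp
qed

lemma set_norm_power_submult:
  assumes "C \<ge> 0" "\<And>A x. A \<in> S \<Longrightarrow> N (A *v x) \<le> C * N x"
  shows "set_norm N (set_power S (m + n)) \<le> set_norm N (set_power S m) * set_norm N (set_power S n)"
proof (rule set_norm_le)
  note bound = set_power_bound[OF assms]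
  show "set_norm N (set_power S m) * set_norm N (set_power S n) \<ge> 0"
    using set_norm_nonneg[OF bound] by simp
  fix A x assume "A \<in> set_power S (m + n)"
  then obtain B D where BD: "B \<in> set_power S m" "D \<in> set_power S n" "A = B ** D"
    by (rule set_power_addE)
  have "N (B *v (D *v x)) \<le> set_norm N (set_power S m) * N (D *v x)"
    using bound BD(1) by (rule le_set_norm)
  also have "\<dots> \<le> set_norm N (set_power S m) * (set_norm N (set_power S n) * N x)"
    using le_set_norm[OF bound BD(2)] set_norm_nonneg[OF bound] by (intro mult_left_mono)
  finally show "N (A *v x) \<le> set_norm N (set_power S m) * set_norm N (set_power S n) * N x"
    by (simp add: BD(3) matrix_vector_mul_assoc mult.assoc)
qed


section \<open>Adapted norms\<close>

text \<open>The growth assumption makes the supremum finite, and \<open>n = 0\<close> gives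
  \<open>N x \<le> N' x\<close>. If \<open>A\<close> lies in \<open>set_power S n\<close>, then
  \<open>A ** s\<close> lies in \<open>set_power S (Suc n)\<close>; this shift of the exponent costs
  exactly the factor \<open>r\<close>.\<close>

lemma adapted_norm:
  assumes r: "r > 0" and C: "\<And>n A x. A \<in> set_power S n \<Longrightarrow> N (A *v x) \<le> C * r ^ n * N x"
  shows "\<exists>N'. ultrametric_norm v N' \<and> (\<forall>x. N x \<le> N' x) \<and> (\<forall>s\<in>S. \<forall>x. N' (s *v x) \<le> r * N' x)"
proof -
  define T where "T = (\<lambda>x. {N (A *v x) / r ^ n | A n. A \<in> set_power S n})"
  define N' where "N' = (\<lambda>x. Sup (T x))"
  have ne: "T x \<noteq> {}" for x
    using set_power_0[of S] by (auto simp: T_def)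
  have "bdd_above (T x)" for x
    unfolding T_def using C r
    by (intro bdd_aboveI[of _ "C * N x"]) (auto simp: pos_divide_le_eq mult_ac)
  hence upper: "N (A *v x) / r ^ n \<le> N' x" if "A \<in> set_power S n" for A n x
    unfolding N'_def using that by (intro cSup_upper) (auto simp: T_def)
  have least: "N' x \<le> c" if "\<And>A n. A \<in> set_power S n \<Longrightarrow> N (A *v x) / r ^ n \<le> c" for x c
    unfolding N'_def using ne that by (intro cSup_least) (auto simp: T_def)
  have le: "N x \<le> N' x" for x
    using upper[of "mat 1" 0 x] by (simp add: set_power_0)
  have nonneg': "N' x \<ge> 0" for x
    using le[of x] nonneg[of x] by linarith
  \<comment> \<open>Only this inequality needs the supremum; the converse follows by applying it to
    \<open>inverse c\<close>.\<close>
  have scale_le: "N' (c *s x) \<le> v c * N' x" for c x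
  proof (rule least)
    fix A n assume "A \<in> set_power S n"
    from mult_left_mono[OF upper[OF this, of x] abs.nonneg[of c]]
    show "N (A *v (c *s x)) / r ^ n \<le> v c * N' x"
      by (simp add: vec.scale scale)
  qed
  have "ultrametric_norm v N'"
  proof
    show "N' x \<ge> 0" for x by (rule nonneg')
    show "N' (c *s x) = v c * N' x" for c x
    proof (cases "c = 0")
      case True
      thus ?thesis using scale_le[of c x] nonneg'[of "c *s x"] by simp
    next
      case False
      hence "v c > 0"
        using abs.nonneg[of c] abs.eq_0_iff[of c] by linarith
      moreover have "N' x \<le> inverse (v c) * N' (c *s x)"
        using scale_le[of "inverse c" "c *s x"] False by (simp add: abs.v_inverse)
      ultimately have "v c * N' x \<le> N' (c *s x)" by (simp add: field_simps)
      thus ?thesis using scale_le[of c x] by linarith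
    qed
    show "N' (x + y) \<le> max (N' x) (N' y)" for x y
    proof (rule least)
      fix A n assume A: "A \<in> set_power S n"
      have "N (A *v (x + y)) / r ^ n \<le> max (N (A *v x)) (N (A *v y)) / r ^ n"
        using ultra r by (simp add: vec.add divide_right_mono)
      also have "\<dots> \<le> max (N' x) (N' y)"
        using upper[OF A, of x] upper[OF A, of y] by (simp add: max_def)
      finally show "N (A *v (x + y)) / r ^ n \<le> max (N' x) (N' y)" .
    qed
    show "N' x = 0 \<longleftrightarrow> x = 0" for x
      using le[of x] pos[of x] scale_le[of 0 0] nonneg'[of 0] by fastforce
  qed
  moreover have "N' (s *v x) \<le> r * N' x" if "s \<in> S" for s x
  proof (rule least)
    fix A n assume "A \<in> set_power S n"
    from upper[OF set_power_mult_right[OF this that], of x] r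
    show "N (A *v (s *v x)) / r ^ n \<le> r * N' x"
      by (simp add: matrix_vector_mul_assoc field_simps)
  qed
  ultimately show ?thesis using le by blast
qed

text \<open>The slack \<open>q < r\<close> compensates for infima that need not be attained. In the
  relation solved for \<open>y j\<close>, \<open>r \<le> M\<close> makes the terms before
  \<open>j\<close> small for \<open>N\<close>, and \<open>q < r\<close> makes those after
  \<open>j\<close> small for \<open>N'\<close>.\<close>

lemma orbit_bound:
  fixes X :: "nat \<Rightarrow> 'k ^ 'n"
  defines "d \<equiv> CARD('n)"
  assumes N': "ultrametric_norm v N'" "\<And>x. N x \<le> N' x"
    and NS: "\<And>A x. A \<in> S \<Longrightarrow> N (A *v x) \<le> M * N x"
    and N'S: "\<And>A x. A \<in> S \<Longrightarrow> N' (A *v x) \<le> q * N' x"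
    and q: "0 < q" "q < r" "r \<le> M"
    and X: "\<And>k. k < d \<Longrightarrow> \<exists>A\<in>S. X (Suc k) = A *v X k"
  shows "N (X d) \<le> r * M ^ (d - 1) * N (X 0)"
proof (rule ccontr)
  interpret N': ultrametric_vector_space v N'
    using N'(1) by (simp add: ultrametric_vector_space_def abs.nonarch_abs_axioms)
  assume "\<not> ?thesis"
  hence large: "r * M ^ (d - 1) * N (X 0) < N (X d)" by simp
  have pos: "r > 0" "M > 0" using q by simp_all
  have D: "N (X d) > 0"
    using large nonneg[of "X 0"] pos by (smt (verit) mult_nonneg_nonneg zero_le_power)
  \<comment> \<open>The radii grow by the factor \<open>M\<close> at each step, so matrices of
    \<open>S\<close> map the ball around \<open>X k\<close> into the ball around
    \<open>X (Suc k)\<close>; the last radius is \<open>N (X d)\<close>.\<close>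
  define \<delta> where "\<delta> = (\<lambda>k. N (X d) / M ^ (d - k))"
  have \<delta>: "\<delta> k > 0" for k using D pos by (simp add: \<delta>_def)
  have \<delta>_Suc: "\<delta> (Suc k) = M * \<delta> k" if "k < d" for k
    using that pos by (simp add: \<delta>_def Suc_diff_Suc[symmetric])
  have X_Suc: "N (X (Suc k)) \<le> M * N (X k)" if "k < d" for k
    using X[OF that] NS by auto
  have X_le: "N (X k) \<le> M ^ k * N (X 0)" if "k \<le> d" for k
    using that
  proof (induction k)
    case (Suc k)
    hence "N (X (Suc k)) \<le> M * N (X k)" by (intro X_Suc) simp
    also have "\<dots> \<le> M * (M ^ k * N (X 0))"
      using Suc pos by (intro mult_left_mono) auto
    finally show ?case by (simp add: mult.assoc)
  qed simp
  have le_X: "\<delta> k \<le> N (X k)" if "k \<le> d" for k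
    using that
  proof (induction rule: inc_induct)
    case (step k)
    hence "M * \<delta> k \<le> M * N (X k)"
      using \<delta>_Suc[of k] X_Suc[of k] by simp
    thus ?case using pos by simp
  qed (simp add: \<delta>_def)

  define B where "B = (\<lambda>k. {y. N (X k - y) < \<delta> k})"
  define \<kappa> where "\<kappa> = (\<lambda>k. INF y\<in>B k. N' y)"
  have B_ne: "B k \<noteq> {}" for k
    using \<delta>[of k] by (auto simp: B_def intro!: exI[of _ "X k"])
  have bdd: "bdd_below (N' ` B k)" for k
    using N'.nonneg by (intro bdd_belowI2[of _ 0])
  have \<kappa>_le: "\<kappa> k \<le> N' y" if "y \<in> B k" for k y
    unfolding \<kappa>_def using bdd that by (rule cINF_lower)
  have \<kappa>_pos: "\<kappa> k > 0" if "k \<le> d" for k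
  proof -
    \<comment> \<open>The ball avoids 0: its radius is at most \<open>N (X k)\<close>, so each
      \<open>y\<close> in it has \<open>N y \<ge> \<delta> k\<close>.\<close>
    have "\<delta> k \<le> \<kappa> k"
      unfolding \<kappa>_def
    proof (rule cINF_greatest[OF B_ne])
      fix y assume "y \<in> B k"
      moreover have "N (X k) \<le> max (N (X k - y)) (N y)"
        using ultra[of "X k - y" y] by simp
      ultimately show "\<delta> k \<le> N' y"
        using le_X[OF that] N'(2)[of y] by (simp add: B_def)
    qed
    thus ?thesis using \<delta>[of k] by linarith
  qed
  \<comment> \<open>A near-minimiser in \<open>B k\<close> is mapped into \<open>B (Suc k)\<close>,
    while \<open>N'\<close> grows at most by the factor \<open>q\<close>.\<close>
  have \<kappa>_Suc: "\<kappa> (Suc k) \<le> q * \<kappa> k" if k: "k < d" for k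
  proof -
    obtain A where A: "A \<in> S" "X (Suc k) = A *v X k" using X[OF k] by blast
    have "\<kappa> (Suc k) / q \<le> (INF y\<in>B k. N' y)"
    proof (rule cINF_greatest[OF B_ne])
      fix y assume y: "y \<in> B k"
      have "N (X (Suc k) - A *v y) \<le> M * N (X k - y)"
        using NS[OF A(1), of "X k - y"] by (simp add: A(2) vec.diff)
      also have "\<dots> < \<delta> (Suc k)"
        using y pos \<delta>_Suc[OF k] by (simp add: B_def)
      finally have "\<kappa> (Suc k) \<le> N' (A *v y)"
        by (intro \<kappa>_le) (simp add: B_def)
      thus "\<kappa> (Suc k) / q \<le> N' y"
        using N'S[OF A(1), of y] q by (simp add: field_simps)
    qed
    hence "\<kappa> (Suc k) / q \<le> \<kappa> k" by (simp add: \<kappa>_def)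
    thus ?thesis using q by (simp add: pos_divide_le_eq mult.commute)
  qed
  have \<kappa>_add: "\<kappa> (j + i) \<le> q ^ i * \<kappa> j" if "j + i \<le> d" for i j
    using that
  proof (induction i)
    case (Suc i)
    hence "\<kappa> (j + Suc i) \<le> q * \<kappa> (j + i)" using \<kappa>_Suc[of "j + i"] by simp
    also have "\<dots> \<le> q * (q ^ i * \<kappa> j)"
      using Suc q by (intro mult_left_mono) auto
    finally show ?case by (simp add: mult.assoc)
  qed simp

  have "\<exists>y. k \<le> d \<longrightarrow> y \<in> B k \<and> N' y < r / q * \<kappa> k" for k
  proof (cases "k \<le> d")
    case True
    have "1 < r / q" using q by simp
    from mult_strict_right_mono[OF this \<kappa>_pos[OF True]]
    have "\<kappa> k < r / q * \<kappa> k" by simp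
    thus ?thesis
      using cINF_less_iff[OF B_ne bdd, of k "r / q * \<kappa> k"] by (auto simp: \<kappa>_def)
  qed simp
  then obtain y where y: "\<And>k. k \<le> d \<Longrightarrow> y k \<in> B k" "\<And>k. k \<le> d \<Longrightarrow> N' (y k) < r / q * \<kappa> k"
    by metis
  have Ny: "N (y k) \<le> M ^ k * N (X 0)" if "k \<le> d" for k
  proof -
    have "N (y k) \<le> max (N (X k)) (N (X k - y k))"
      using ultra_diff[of "X k" "X k - y k"] by simp
    thus ?thesis
      using y(1)[OF that] le_X[OF that] X_le[OF that] by (simp add: B_def)
  qed

  obtain a where a: "\<exists>k\<le>d. a k \<noteq> 0" "(\<Sum>k\<le>d. a k *s y k) = 0"
    using linear_relation[of y] unfolding d_def by blast
  \<comment> \<open>Maximality of \<open>f j\<close> bounds the quotient of \<open>v (a k)\<close>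
    by \<open>v (a j)\<close> by \<open>r\<close> to the power \<open>j - k\<close>, on both sides
    of \<open>j\<close>.\<close>
  define f where "f = (\<lambda>k. v (a k) * r ^ k)"
  have "Max (f ` {..d}) \<in> f ` {..d}" by (intro Max_in) auto
  then obtain j where j: "j \<le> d" "f j = Max (f ` {..d})" by (metis atMost_iff imageE)
  have f_le: "f k \<le> f j" if "k \<le> d" for k
    unfolding j(2) using that by (intro Max_ge) auto
  have aj: "a j \<noteq> 0"
  proof
    assume "a j = 0"
    hence "f k \<le> 0" if "k \<le> d" for k using f_le[OF that] by (simp add: f_def)
    hence "v (a k) \<le> 0" if "k \<le> d" for k using mult_le_0_iff[of "v (a k)" "r ^ k"] zero_less_power[OF pos(1), of k] that
      unfolding f_def by (metis not_le)
    thus False using a(1) abs.nonneg abs.eq_0_iff by (metis order_antisym)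
  qed
  define b where "b = (\<lambda>k. - inverse (a j) * a k)"
  have vb: "v (b k) * r ^ k \<le> r ^ j" if "k \<le> d" for k
  proof -
    have "v (a j) > 0" using aj abs.nonneg[of "a j"] abs.eq_0_iff[of "a j"] by linarith
    thus ?thesis
      using f_le[OF that] by (simp add: b_def f_def abs.mult abs.v_inverse) (simp add: field_simps)
  qed
  define u z where "u = (\<Sum>k<j. b k *s y k)" and "z = (\<Sum>k\<in>{j<..d}. b k *s y k)"
  have yj: "y j = u + z"
  proof -
    have "{..d} = insert j ({..<j} \<union> {j<..d})" using j(1) by auto
    moreover have "(\<Sum>k\<in>{..<j} \<union> {j<..d}. a k *s y k) = (\<Sum>k<j. a k *s y k) + (\<Sum>k\<in>{j<..d}. a k *s y k)"
      by (rule sum.union_disjoint) auto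
    ultimately have "a j *s y j + ((\<Sum>k<j. a k *s y k) + (\<Sum>k\<in>{j<..d}. a k *s y k)) = 0"
      using a(2) by simp
    hence "a j *s y j = - ((\<Sum>k<j. a k *s y k) + (\<Sum>k\<in>{j<..d}. a k *s y k))"
      by (simp only: eq_neg_iff_add_eq_0)
    hence "inverse (a j) *s (a j *s y j) =
        inverse (a j) *s (- ((\<Sum>k<j. a k *s y k) + (\<Sum>k\<in>{j<..d}. a k *s y k)))"
      by (rule arg_cong)
    moreover have "u = - inverse (a j) *s (\<Sum>k<j. a k *s y k)"
      "z = - inverse (a j) *s (\<Sum>k\<in>{j<..d}. a k *s y k)"
      by (simp_all add: u_def z_def b_def vec.scale_sum_right)
    ultimately show ?thesis using aj by (simp add: vec.scale_right_distrib)
  qed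

  \<comment> \<open>Each term is at most \<open>r * M ^ (j - 1) * N (X 0)\<close>. After
    multiplication by \<open>M ^ (d - j)\<close> the claim becomes the assumed violation
    \<open>large\<close>.\<close>
  have "N u < \<delta> j"
    unfolding u_def
  proof (rule sum_less[OF \<delta>])
    fix k assume "k \<in> {..<j}"
    then obtain i where i: "j = k + Suc i" using less_iff_Suc_add[of k j] by auto
    have "v (b k) * r ^ k \<le> r ^ Suc i * r ^ k"
      using vb[of k] i j(1) by (simp add: power_add mult_ac)
    hence "v (b k) \<le> r * r ^ i" using pos by simp
    also have "\<dots> \<le> r * M ^ i" using q by (intro mult_left_mono power_mono) auto
    finally have "v (b k) * N (y k) \<le> (r * M ^ i) * (M ^ k * N (X 0))"
      using Ny[of k] i j(1) nonneg pos by (intro mult_mono) auto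
    also have "\<dots> < \<delta> j"
    proof -
      have "(r * M ^ i) * (M ^ k * N (X 0)) * M ^ (d - j) = r * M ^ (i + k + (d - j)) * N (X 0)"
        by (simp add: power_add mult_ac)
      also have "i + k + (d - j) = d - 1" using i j(1) by simp
      also have "r * M ^ (d - 1) * N (X 0) < N (X d)" by (rule large)
      finally show ?thesis using pos by (simp only: \<delta>_def pos_less_divide_eq zero_less_power)
    qed
    finally show "N (b k *s y k) < \<delta> j" by (simp add: scale)
  qed
  moreover have "N (X j - y j) < \<delta> j" using y(1)[OF j(1)] by (simp add: B_def)
  \<comment> \<open>\<open>X j - z\<close> is the sum of \<open>X j - y j\<close> and
    \<open>u\<close>, both of norm below \<open>\<delta> j\<close>.\<close>
  ultimately have "z \<in> B j"
    using ultra[of "X j - y j" u] by (simp add: B_def yj)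
  hence "\<kappa> j \<le> N' z" by (rule \<kappa>_le)
  \<comment> \<open>For \<open>k = j + Suc i\<close> the coefficient contributes at most
    \<open>r\<close> to the power \<open>-(i + 1)\<close> and \<open>y k\<close> less than
    \<open>r * q ^ i * \<kappa> j\<close>, so the powers of \<open>r\<close> cancel. Strictness
    comes from the choice of \<open>y k\<close>, hence the separate case of a zero
    coefficient.\<close>
  moreover have "N' z < \<kappa> j"
    unfolding z_def
  proof (rule N'.sum_less[OF \<kappa>_pos[OF j(1)]])
    fix k assume "k \<in> {j<..d}"
    then obtain i where i: "k = j + Suc i" and k: "k \<le> d"
      using less_iff_Suc_add[of j k] by auto
    show "N' (b k *s y k) < \<kappa> j"
    proof (cases "b k = 0")
      case False
      hence vpos: "v (b k) > 0" using abs.nonneg[of "b k"] abs.eq_0_iff[of "b k"] by linarith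
      have "v (b k) * r ^ Suc i * r ^ j \<le> 1 * r ^ j"
        using vb[OF k] by (simp add: i power_add mult_ac)
      hence vb1: "v (b k) * r ^ Suc i \<le> 1" using pos by simp
      have "v (b k) * N' (y k) < v (b k) * (r / q * \<kappa> k)"
        using y(2)[OF k] vpos by (rule mult_strict_left_mono)
      also have "\<dots> \<le> v (b k) * (r / q * (q ^ Suc i * \<kappa> j))"
        using \<kappa>_add[of j "Suc i"] k i pos q vpos
        by (intro mult_left_mono) auto
      also have "\<dots> = v (b k) * (r * q ^ i) * \<kappa> j" using q by simp
      also have "\<dots> \<le> v (b k) * (r * r ^ i) * \<kappa> j"
        using q \<kappa>_pos[OF j(1)] vpos
        by (intro mult_right_mono mult_left_mono power_mono) auto
      also have "\<dots> \<le> \<kappa> j"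
        using mult_right_mono[OF vb1 less_imp_le[OF \<kappa>_pos[OF j(1)]]] by simp
      finally show ?thesis by (simp add: N'.scale)
    qed (use \<kappa>_pos[OF j(1)] in simp)
  qed
  ultimately show False by simp
qed

text \<open>For \<open>r \<le> M\<close> a product of matrices is read as an orbit; for
  \<open>r > M\<close> the crude bound by the power of \<open>M\<close> already suffices.\<close>

lemma set_norm_power_card_le:
  assumes N': "ultrametric_norm v N'" "\<And>x. N x \<le> N' x"
    and NS: "\<And>A x. A \<in> S \<Longrightarrow> N (A *v x) \<le> M * N x"
    and N'S: "\<And>A x. A \<in> S \<Longrightarrow> N' (A *v x) \<le> q * N' x"
    and q: "0 < q" "q < r" "0 \<le> M"
  shows "set_norm N (set_power S CARD('n)) \<le> r * M ^ (CARD('n) - 1)"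
proof (rule set_norm_le)
  fix A x assume A: "A \<in> set_power S CARD('n)"
  show "N (A *v x) \<le> r * M ^ (CARD('n) - 1) * N x"
  proof (cases "r \<le> M")
    case True
    obtain ss where ss: "A = foldr (**) ss (mat 1)" "length ss = CARD('n)" "set ss \<subseteq> S"
      using A by (rule set_powerE)
    \<comment> \<open>The rightmost factor acts first, so \<open>X k\<close> applies the last
      \<open>k\<close> factors of the word.\<close>
    define X where "X = (\<lambda>k. foldr (**) (drop (CARD('n) - k) ss) (mat 1) *v x)"
    have "N (X CARD('n)) \<le> r * M ^ (CARD('n) - 1) * N (X 0)"
    proof (rule orbit_bound[OF N' NS N'S q(1,2) True])
      fix k assume k: "k < CARD('n)"
      define i where "i = CARD('n) - Suc k"
      have i: "i < length ss" "CARD('n) - k = Suc i" using k ss(2) by (auto simp: i_def)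
      have "X (Suc k) = ss ! i *v X k"
        using Cons_nth_drop_Suc[OF i(1), symmetric]
        by (simp add: X_def i(2) i_def[symmetric] matrix_vector_mul_assoc)
      thus "\<exists>A\<in>S. X (Suc k) = A *v X k" using i(1) ss(3) nth_mem by blast
    qed
    thus ?thesis using ss by (simp add: X_def)
  next
    case False
    have "N (A *v x) \<le> M ^ CARD('n) * N x"
      using q(3) NS A by (rule set_power_bound)
    also have "M ^ CARD('n) = M * M ^ (CARD('n) - 1)"
      by (simp add: power_eq_if)
    also have "\<dots> * N x \<le> r * M ^ (CARD('n) - 1) * N x"
      using False q(3) nonneg by (intro mult_right_mono) auto
    finally show ?thesis .
  qed
qed (use q in simp)

end

section \<open>Transfer between the two norms and passage to the limit\<close>

theorem theorem8:
  fixes v :: "'k::alg_closed_field \<Rightarrow> real"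
    and N\<^sub>0 N :: "'k ^ 'd::finite \<Rightarrow> real"
    and S :: "('k ^ 'd ^ 'd) set"
  assumes "complete_nontrivial_nonarch_abs v"
    and "ultrametric_norm v N\<^sub>0"
    and "ultrametric_norm v N"
    and "bounded_matrices v S"
  shows "set_norm N\<^sub>0 (set_power S CARD('d))
      \<le> joint_spectral_radius N S * set_norm N\<^sub>0 S ^ (CARD('d) - 1)"
proof -
  interpret v: complete_nontrivial_nonarch_abs v by fact
  interpret N0: complete_ultrametric_vector_space v N\<^sub>0
    using assms(2) v.complete v.nonarch_abs_axioms
    by (simp add: complete_ultrametric_vector_space_def ultrametric_vector_space_def
        complete_ultrametric_vector_space_axioms_def)
  interpret N: complete_ultrametric_vector_space v N
    using assms(3) v.complete v.nonarch_abs_axioms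
    by (simp add: complete_ultrametric_vector_space_def ultrametric_vector_space_def
        complete_ultrametric_vector_space_axioms_def)
  obtain C0 where C0: "\<And>A x. A \<in> S \<Longrightarrow> N\<^sub>0 (A *v x) \<le> C0 * N\<^sub>0 x"
    using N0.bounded_matrices_imp_bounded[OF assms(4)] by blast
  obtain C where C: "C > 0" "\<And>A x. A \<in> S \<Longrightarrow> N (A *v x) \<le> C * N x"
    using N.bounded_matrices_imp_bounded[OF assms(4)] by blast
  obtain E where E: "E > 0" "\<And>x. N\<^sub>0 x \<le> E * N x"
    using N.equivalent[OF assms(2)] by blast
  obtain E' where E': "E' > 0" "\<And>x. N x \<le> E' * N\<^sub>0 x"
    using N0.equivalent[OF assms(3)] by blast
  define M where "M = set_norm N\<^sub>0 S"
  define a where "a = (\<lambda>n. set_norm N (set_power S n))"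
  define \<rho> where "\<rho> = joint_spectral_radius N S"
  note bound = N.set_power_bound[OF less_imp_le[OF C(1)] C(2)]
  have M0: "M \<ge> 0" unfolding M_def using C0 by (rule N0.set_norm_nonneg)
  have a: "a n \<ge> 0" "a (m + n) \<le> a m * a n" for m n
    unfolding a_def using N.set_norm_nonneg[OF bound]
      N.set_norm_power_submult[OF less_imp_le[OF C(1)] C(2)] by auto
  have lim: "(\<lambda>n. root n (a n)) \<longlonglongrightarrow> \<rho>"
    unfolding \<rho>_def joint_spectral_radius_def a_def[symmetric]
    using submultiplicative_root_convergent[OF a] by (simp add: convergent_LIMSEQ_iff a_def)
  have \<rho>0: "\<rho> \<ge> 0"
    using lim by (rule LIMSEQ_le_const) (intro exI[of _ 1], simp add: a(1))
  have le: "set_norm N\<^sub>0 (set_power S CARD('d)) \<le> r * M ^ (CARD('d) - 1)" if "\<rho> < r" for r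
  proof -
    \<comment> \<open>The adapted norm is built for \<open>q\<close>, which leaves the strict slack
      below \<open>r\<close>.\<close>
    obtain q where q: "\<rho> < q" "q < r" using dense[OF \<open>\<rho> < r\<close>] by blast
    have q0: "q > 0" using q \<rho>0 by simp
    have "eventually (\<lambda>n. root n (a n) < q \<and> n > 0) sequentially"
      using order_tendstoD(2)[OF lim q(1)] eventually_gt_at_top[of 0] by (rule eventually_conj)
    then obtain m where m: "m > 0" "root m (a m) < q"
      by (auto dest: eventually_happens)
    then obtain F where F: "\<And>n. a n \<le> F * q ^ n"
      using submultiplicative_bound[OF a] by blast
    \<comment> \<open>The growth rate \<open>q\<close> is known for \<open>N\<close>, which computes
      \<rho>; passing to \<open>N\<^sub>0\<close> and back changes only the constant.\<close>
    have "N\<^sub>0 (A *v x) \<le> (E * F * E') * q ^ n * N\<^sub>0 x" if A: "A \<in> set_power S n" for n A x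
    proof -
      have "N\<^sub>0 (A *v x) \<le> E * N (A *v x)" by (rule E)
      also have "\<dots> \<le> E * (a n * N x)"
        unfolding a_def using N.le_set_norm[OF bound A] E by simp
      also have "\<dots> \<le> E * (a n * (E' * N\<^sub>0 x))"
        using E' E a by (simp add: mult_left_mono)
      also have "\<dots> \<le> E * ((F * q ^ n) * (E' * N\<^sub>0 x))"
        using F E E' N0.nonneg by (intro mult_left_mono mult_right_mono) auto
      finally show ?thesis by (simp add: mult_ac)
    qed
    from N0.adapted_norm[OF q0 this] obtain N' where N': "ultrametric_norm v N'"
      "\<And>x. N\<^sub>0 x \<le> N' x" "\<And>A x. A \<in> S \<Longrightarrow> N' (A *v x) \<le> q * N' x"
      by blast
    have M: "N\<^sub>0 (A *v x) \<le> M * N\<^sub>0 x" if "A \<in> S" for A x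
      unfolding M_def using C0 that by (rule N0.le_set_norm)
    show ?thesis
      using N'(1,2) M N'(3) q0 q(2) M0 by (rule N0.set_norm_power_card_le)
  qed
  \<comment> \<open>Letting \<open>r\<close> decrease to \<rho> removes the slack, the bound being
    continuous in \<open>r\<close>.\<close>
  have "((\<lambda>r. r * M ^ (CARD('d) - 1)) \<longlongrightarrow> \<rho> * M ^ (CARD('d) - 1)) (at_right \<rho>)"
    by (intro tendsto_intros)
  hence "set_norm N\<^sub>0 (set_power S CARD('d)) \<le> \<rho> * M ^ (CARD('d) - 1)"
    by (rule tendsto_lowerbound)
      (use le in \<open>auto simp: eventually_at_right_field intro: exI[of _ "\<rho> + 1"]\<close>)
  thus ?thesis by (simp add: \<rho>_def M_def)
qed

end
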